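(* Let $M\models\mathsf{ZFA}$ and let $M_1$ be its D-graph. Then, up to isomorphism (in the sense of the metatheory), the connected components of $M_1$ are exactly the connected components (in the sense of the metatheory) of graphs in the sense of $M$: every connected component of $M_1$ is isomorphic to a connected component of some graph in $M$, and every connected component of a graph in $M$ is isomorphic to a connected component of $M_1$. Moreover, for each such connected component, $M_1$ has infinitely many connected components isomorphic to it.
   Context: The ambient metatheory is $\mathsf{ZFC}+\mathrm{Con}(\mathsf{ZFC})$. $\mathsf{ZFA}$ is $\mathsf{ZFC}$ with the Axiom of Foundation replaced by the Anti-Foundation Axiom: every flat system of equations $\{x=S_x\mid x\in X\}$, with $X$ a set of indeterminates and each $S_x\subseteq X\cup A$ for some set $A$ of sets, has a unique solution. A "graph" is a structure with a single symmetric binary relation (loops allowed). For an $\{\in\}$-structure $M$, let $D(x,y)$ be $x\in y\wedge y\in x$; the D-graph $M_1$ of $M$ is the reduct of $M$ to the language $\{D\}$. A graph in the sense of $M$ is one whose domain and edge relation are elements of $M$ (the edge relation symmetric in $M$), viewed in the metatheory as the structure on $\{c\in M\mid M\models c\in\operatorname{dom}G\}$ with the edge relation computed in $M$. Connected components are taken in the metatheory. *)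

theory Defs
  imports Main
begin

section \<open>First-order formulas in the language of set theory\<close>

datatype fm = Mem nat nat | Eq nat nat | Neg fm | Conj fm fm | All nat fm

primrec sat :: "('a \<Rightarrow> 'a \<Rightarrow> bool) \<Rightarrow> (nat \<Rightarrow> 'a) \<Rightarrow> fm \<Rightarrow> bool" where
  "sat E e (Mem i j) \<longleftrightarrow> E (e i) (e j)"
| "sat E e (Eq i j) \<longleftrightarrow> e i = e j"
| "sat E e (Neg \<phi>) \<longleftrightarrow> \<not> sat E e \<phi>"
| "sat E e (Conj \<phi> \<psi>) \<longleftrightarrow> sat E e \<phi> \<and> sat E e \<psi>"
| "sat E e (All i \<phi>) \<longleftrightarrow> (\<forall>a. sat E (e(i := a)) \<phi>)"


section \<open>Set-theoretic notions evaluated in a structure\<close>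

text \<open>An \<open>\<in>\<close>-structure \<open>M\<close> is a type \<open>'a\<close> together with a relation \<open>E\<close> interpreting
  membership: \<open>E x y\<close> means \<open>M \<Turnstile> x \<in> y\<close>.\<close>

definition is_upair :: "('a \<Rightarrow> 'a \<Rightarrow> bool) \<Rightarrow> 'a \<Rightarrow> 'a \<Rightarrow> 'a \<Rightarrow> bool" where
  "is_upair E p a b \<longleftrightarrow> (\<forall>z. E z p \<longleftrightarrow> z = a \<or> z = b)"

definition is_opair :: "('a \<Rightarrow> 'a \<Rightarrow> bool) \<Rightarrow> 'a \<Rightarrow> 'a \<Rightarrow> 'a \<Rightarrow> bool" where
  "is_opair E p a b \<longleftrightarrow> (\<exists>s t. is_upair E s a a \<and> is_upair E t a b \<and> is_upair E p s t)"

text \<open>\<open>pair_in E r x y\<close> means \<open>M \<Turnstile> (x, y) \<in> r\<close>.\<close>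

definition pair_in :: "('a \<Rightarrow> 'a \<Rightarrow> bool) \<Rightarrow> 'a \<Rightarrow> 'a \<Rightarrow> 'a \<Rightarrow> bool" where
  "pair_in E r x y \<longleftrightarrow> (\<exists>p. is_opair E p x y \<and> E p r)"

definition is_function_on :: "('a \<Rightarrow> 'a \<Rightarrow> bool) \<Rightarrow> 'a \<Rightarrow> 'a \<Rightarrow> bool" where
  "is_function_on E f X \<longleftrightarrow>
     (\<forall>p. E p f \<longrightarrow> (\<exists>x y. E x X \<and> is_opair E p x y)) \<and>
     (\<forall>x. E x X \<longrightarrow> (\<exists>!y. pair_in E f x y))"

text \<open>A flat system \<open>{x = S\<^sub>x | x \<in> X}\<close> is represented by the function \<open>x \<mapsto> S\<^sub>x\<close>, an element
  \<open>S\<close> of \<open>M\<close>.\<close>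

definition is_flat_system :: "('a \<Rightarrow> 'a \<Rightarrow> bool) \<Rightarrow> 'a \<Rightarrow> 'a \<Rightarrow> 'a \<Rightarrow> bool" where
  "is_flat_system E X A S \<longleftrightarrow>
     is_function_on E S X \<and>
     (\<forall>x s z. E x X \<longrightarrow> pair_in E S x s \<longrightarrow> E z s \<longrightarrow> E z X \<or> E z A)"

text \<open>A solution \<open>f\<close> satisfies \<open>f(x) = {f(y) | y \<in> S\<^sub>x \<inter> X} \<union> (S\<^sub>x - X)\<close>: every
  occurrence of an element of \<open>X\<close> counts as an indeterminate, also if \<open>X\<close> and \<open>A\<close> overlap.\<close>

definition is_solution :: "('a \<Rightarrow> 'a \<Rightarrow> bool) \<Rightarrow> 'a \<Rightarrow> 'a \<Rightarrow> 'a \<Rightarrow> bool" where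
  "is_solution E X S f \<longleftrightarrow>
     is_function_on E f X \<and>
     (\<forall>x s v. E x X \<longrightarrow> pair_in E S x s \<longrightarrow> pair_in E f x v \<longrightarrow>
        (\<forall>z. E z v \<longleftrightarrow> (\<exists>y. E y s \<and> E y X \<and> pair_in E f y z) \<or> (E z s \<and> \<not> E z X)))"


section \<open>Models of ZFA\<close>

text \<open>In the two schemas the environment \<open>e\<close> supplies the parameters.\<close>

locale ZFA_model =
  fixes E :: "'a \<Rightarrow> 'a \<Rightarrow> bool"
  assumes extensionality: "(\<forall>z. E z x \<longleftrightarrow> E z y) \<Longrightarrow> x = y"
    and pairing: "\<exists>p. is_upair E p a b"
    and union: "\<exists>u. \<forall>z. E z u \<longleftrightarrow> (\<exists>y. E y a \<and> E z y)"
    and power_set: "\<exists>p. \<forall>z. E z p \<longleftrightarrow> (\<forall>w. E w z \<longrightarrow> E w a)"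
    and infinity: "\<exists>i. (\<exists>o'. (\<forall>z. \<not> E z o') \<and> E o' i) \<and>
          (\<forall>x. E x i \<longrightarrow> (\<exists>s. (\<forall>z. E z s \<longleftrightarrow> E z x \<or> z = x) \<and> E s i))"
    and separation: "\<exists>b. \<forall>x. E x b \<longleftrightarrow> E x a \<and> sat E (e(0 := x)) \<phi>"
    and replacement: "(\<forall>x. E x a \<longrightarrow> (\<exists>!y. sat E (e(0 := x, 1 := y)) \<phi>)) \<Longrightarrow>
          \<exists>b. \<forall>y. E y b \<longleftrightarrow> (\<exists>x. E x a \<and> sat E (e(0 := x, 1 := y)) \<phi>)"
    and choice: "(\<forall>x. E x a \<longrightarrow> (\<exists>z. E z x)) \<Longrightarrow>
          (\<forall>x y. E x a \<longrightarrow> E y a \<longrightarrow> x \<noteq> y \<longrightarrow> \<not> (\<exists>z. E z x \<and> E z y)) \<Longrightarrow>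
          \<exists>c. \<forall>x. E x a \<longrightarrow> (\<exists>!z. E z x \<and> E z c)"
    and anti_foundation: "is_flat_system E X A S \<Longrightarrow> \<exists>!f. is_solution E X S f"


section \<open>Graphs, components and isomorphism in the metatheory\<close>

text \<open>A graph is a pair \<open>(V, R)\<close> with \<open>R \<subseteq> V \<times> V\<close> symmetric. For such a pair \<open>R\<^sup>*\<close> is an
  equivalence relation whose class of any \<open>v \<in> V\<close> is contained in \<open>V\<close>.\<close>

type_synonym 'a graph = "'a set \<times> 'a rel"

definition components :: "'a graph \<Rightarrow> 'a graph set" where
  "components G = (\<lambda>C. (C, Restr (snd G) C)) ` (fst G // (snd G)\<^sup>*)"

definition graph_iso :: "'a graph \<Rightarrow> 'b graph \<Rightarrow> bool"  (infix "\<simeq>" 50) where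
  "G \<simeq> H \<longleftrightarrow> (\<exists>f. bij_betw f (fst G) (fst H) \<and>
     (\<forall>x\<in>fst G. \<forall>y\<in>fst G. (x, y) \<in> snd G \<longleftrightarrow> (f x, f y) \<in> snd H))"

definition D_graph :: "('a \<Rightarrow> 'a \<Rightarrow> bool) \<Rightarrow> 'a graph" where
  "D_graph E = (UNIV, {(x, y). E x y \<and> E y x})"

text \<open>\<open>d\<close> and \<open>r\<close> are the domain and the edge relation of a graph in the sense of \<open>M\<close>.\<close>

definition is_graph_in :: "('a \<Rightarrow> 'a \<Rightarrow> bool) \<Rightarrow> 'a \<Rightarrow> 'a \<Rightarrow> bool" where
  "is_graph_in E d r \<longleftrightarrow>
     (\<forall>p. E p r \<longrightarrow> (\<exists>x y. E x d \<and> E y d \<and> is_opair E p x y)) \<and>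
     (\<forall>x y. pair_in E r x y \<longrightarrow> pair_in E r y x)"

definition graph_of :: "('a \<Rightarrow> 'a \<Rightarrow> bool) \<Rightarrow> 'a \<Rightarrow> 'a \<Rightarrow> 'a graph" where
  "graph_of E d r = ({c. E c d}, {(x, y). pair_in E r x y})"

end

theory Submission
  imports Defs
begin

text \<open>A component of \<open>M\<^sub>1\<close> lies inside any transitive set of \<open>M\<close> containing one of its points, and
  restricting \<open>D\<close> to such a set gives a graph in \<open>M\<close> with the same component. Conversely, for a
  graph \<open>(d, r)\<close> in \<open>M\<close> and any \<open>c\<close>, anti-foundation yields sets
  \<open>f(v) = {f(w) | (v, w) \<in> r} \<union> {\<emptyset>, {{(c, v)}}}\<close>. Every \<open>f(v)\<close> contains \<open>\<emptyset>\<close>, while neither the tag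
  \<open>{{(c, v)}}\<close> nor its element does; hence tags are never values of \<open>f\<close> and never contain one. So
  \<open>f\<close> is injective and the \<open>D\<close>-neighbours of \<open>f(v)\<close> are exactly the \<open>f(w)\<close> with \<open>(v, w) \<in> r\<close>, and
  each component of the graph is copied onto a component of \<open>M\<^sub>1\<close>. Different \<open>c\<close> give different
  components, and \<open>M\<close> is infinite.\<close>

section \<open>Renaming variables of formulas\<close>

primrec rename :: "(nat \<Rightarrow> nat) \<Rightarrow> fm \<Rightarrow> fm" where
  "rename \<rho> (Mem i j) = Mem (\<rho> i) (\<rho> j)"
| "rename \<rho> (Eq i j) = Eq (\<rho> i) (\<rho> j)"
| "rename \<rho> (Neg \<phi>) = Neg (rename \<rho> \<phi>)"
| "rename \<rho> (Conj \<phi> \<psi>) = Conj (rename \<rho> \<phi>) (rename \<rho> \<psi>)"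
| "rename \<rho> (All i \<phi>) = All (\<rho> i) (rename \<rho> \<phi>)"

text \<open>Injectivity keeps variables apart under a quantifier: updating the environment at
  \<open>\<rho> i\<close> must change the value seen by \<open>i\<close> alone.\<close>

lemma sat_rename:
  assumes "inj \<rho>"
  shows "sat E e (rename \<rho> \<phi>) \<longleftrightarrow> sat E (\<lambda>i. e (\<rho> i)) \<phi>"
proof (induction \<phi> arbitrary: e)
  case (All i \<phi>)
  have "(\<lambda>j. (e(\<rho> i := a)) (\<rho> j)) = (\<lambda>j. e (\<rho> j))(i := a)" for a
    using assms by (auto simp: fun_eq_iff inj_eq)
  then show ?case by (simp add: All.IH)
qed simp_all

primrec max_var :: "fm \<Rightarrow> nat" where
  "max_var (Mem i j) = max i j"
| "max_var (Eq i j) = max i j"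
| "max_var (Neg \<phi>) = max_var \<phi>"
| "max_var (Conj \<phi> \<psi>) = max (max_var \<phi>) (max_var \<psi>)"
| "max_var (All i \<phi>) = max i (max_var \<phi>)"

lemma sat_cong:
  assumes "\<And>i. i \<le> max_var \<phi> \<Longrightarrow> e i = e' i"
  shows "sat E e \<phi> \<longleftrightarrow> sat E e' \<phi>"
  using assms
proof (induction \<phi> arbitrary: e e')
  case (All i \<phi>)
  have "sat E (e(i := a)) \<phi> \<longleftrightarrow> sat E (e'(i := a)) \<phi>" for a
    by (rule All.IH) (simp add: All.prems)
  then show ?case by simp
next
  case (Conj \<phi> \<psi>)
  have "sat E e \<phi> \<longleftrightarrow> sat E e' \<phi>" "sat E e \<psi> \<longleftrightarrow> sat E e' \<psi>"
    by (rule Conj.IH; simp add: Conj.prems)+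
  then show ?case by simp
next
  case (Neg \<phi>)
  have "sat E e \<phi> \<longleftrightarrow> sat E e' \<phi>"
    by (rule Neg.IH) (simp add: Neg.prems)
  then show ?case by simp
qed auto

section \<open>Components and embeddings of graphs\<close>

lemma infinite_if_inj_family:
  assumes "infinite (UNIV :: 'c set)" "inj (f :: 'c \<Rightarrow> 'b)" "\<And>c. f c \<in> S"
  shows "infinite S"
  using assms finite_subset[of "range f" S] finite_imageD[of f UNIV] by blast

lemma components_eq:
  "components G = (\<lambda>v. (let C = (snd G)\<^sup>* `` {v} in (C, Restr (snd G) C))) ` fst G"
  unfolding components_def quotient_def Let_def by blast

lemma graph_iso_sym: "G \<simeq> H \<Longrightarrow> H \<simeq> G"
  unfolding graph_iso_def
proof (elim exE conjE)
  fix f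
  assume f: "bij_betw f (fst G) (fst H)"
    "\<forall>x\<in>fst G. \<forall>y\<in>fst G. (x, y) \<in> snd G \<longleftrightarrow> (f x, f y) \<in> snd H"
  let ?g = "inv_into (fst G) f"
  have "bij_betw ?g (fst H) (fst G)" using f(1) by (rule bij_betw_inv_into)
  moreover have "(x, y) \<in> snd H \<longleftrightarrow> (?g x, ?g y) \<in> snd G" if "x \<in> fst H" "y \<in> fst H" for x y
    using that f(2) bij_betw_apply[OF calculation] bij_betw_inv_into_right[OF f(1)] by simp
  ultimately show "\<exists>g. bij_betw g (fst H) (fst G) \<and>
      (\<forall>x\<in>fst H. \<forall>y\<in>fst H. (x, y) \<in> snd H \<longleftrightarrow> (g x, g y) \<in> snd G)"
    by blast
qed

lemma graph_iso_trans:
  assumes "G \<simeq> H" "H \<simeq> K"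
  shows "G \<simeq> K"
proof -
  obtain f where f: "bij_betw f (fst G) (fst H)"
    "\<forall>x\<in>fst G. \<forall>y\<in>fst G. (x, y) \<in> snd G \<longleftrightarrow> (f x, f y) \<in> snd H"
    using assms(1) unfolding graph_iso_def by blast
  obtain g where g: "bij_betw g (fst H) (fst K)"
    "\<forall>x\<in>fst H. \<forall>y\<in>fst H. (x, y) \<in> snd H \<longleftrightarrow> (g x, g y) \<in> snd K"
    using assms(2) unfolding graph_iso_def by blast
  have "bij_betw (g \<circ> f) (fst G) (fst K)"
    using f(1) g(1) by (rule bij_betw_trans)
  moreover have "(x, y) \<in> snd G \<longleftrightarrow> ((g \<circ> f) x, (g \<circ> f) y) \<in> snd K"
    if "x \<in> fst G" "y \<in> fst G" for x y
    using that f(2) g(2) bij_betw_apply[OF f(1)] by simp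
  ultimately show ?thesis
    unfolding graph_iso_def by blast
qed

text \<open>The third hypothesis says that the \<open>D\<close>-neighbours of a value
  \<open>f v\<close> are exactly the values at the \<open>R\<close>-neighbours of \<open>v\<close>.
  So a \<open>D\<close>-walk starting in the image never leaves it and lifts step by step to an
  \<open>R\<close>-walk.\<close>

lemma reachable_embedding:
  assumes R: "R \<subseteq> V \<times> V" and v: "v \<in> V"
    and D: "\<And>v z. v \<in> V \<Longrightarrow> (f v, z) \<in> D \<longleftrightarrow> (\<exists>w. (v, w) \<in> R \<and> z = f w)"
  shows "D\<^sup>* `` {f v} = f ` (R\<^sup>* `` {v})"
proof -
  have "z \<in> f ` (R\<^sup>* `` {v})" if "(f v, z) \<in> D\<^sup>*" for z
    using that
  proof (induction rule: rtrancl_induct)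
    case (step y z)
    then obtain w where w: "(v, w) \<in> R\<^sup>*" "y = f w" by blast
    then have "w \<in> V" using v R by (induction rule: rtrancl_induct) auto
    then show ?case using w step.hyps D by (auto intro: rtrancl_into_rtrancl)
  qed blast
  moreover have "(f v, f w) \<in> D\<^sup>*" if "(v, w) \<in> R\<^sup>*" for w
    using that
  proof (induction rule: rtrancl_induct)
    case (step y z)
    then have "(f y, f z) \<in> D" using R D by blast
    then show ?case using step.IH by (rule rtrancl_into_rtrancl[rotated])
  qed blast
  ultimately show ?thesis by blast
qed

text \<open>Injectivity brings edges back: a \<open>D\<close>-edge from \<open>f x\<close> to
  \<open>f y\<close> only yields an \<open>R\<close>-neighbour \<open>w\<close> of \<open>x\<close>
  with \<open>f w = f y\<close>. The lemma serves both directions, once with the identity and once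
  with a solution of a flat system.\<close>

lemma component_iso_embedding:
  assumes R: "R \<subseteq> V \<times> V" and v: "v \<in> V"
    and D: "\<And>v z. v \<in> V \<Longrightarrow> (f v, z) \<in> D \<longleftrightarrow> (\<exists>w. (v, w) \<in> R \<and> z = f w)"
    and f: "inj_on f V"
  shows "(R\<^sup>* `` {v}, Restr R (R\<^sup>* `` {v})) \<simeq> (D\<^sup>* `` {f v}, Restr D (D\<^sup>* `` {f v}))"
proof -
  have reach: "D\<^sup>* `` {f v} = f ` (R\<^sup>* `` {v})"
    by (rule reachable_embedding[OF R v D])
  have sub: "R\<^sup>* `` {v} \<subseteq> V"
  proof
    fix w assume "w \<in> R\<^sup>* `` {v}"
    then have "(v, w) \<in> R\<^sup>*" by blast
    then show "w \<in> V" using v R by (induction rule: rtrancl_induct) auto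
  qed
  have "inj_on f (R\<^sup>* `` {v})" using f sub by (rule inj_on_subset)
  \<comment> \<open>The neighbour \<open>w\<close> provided by \<open>D\<close> equals
    \<open>y\<close> because \<open>f\<close> is injective on \<open>V\<close>.\<close>
  moreover have "(x, y) \<in> R \<longleftrightarrow> (f x, f y) \<in> D" if "x \<in> V" "y \<in> V" for x y
    using that D R inj_onD[OF f] by blast
  ultimately show ?thesis
    unfolding graph_iso_def reach
    by (intro exI[of _ f]) (use sub in \<open>auto simp: bij_betw_def\<close>)
qed

section \<open>Definable predicates and terms\<close>

text \<open>In a definable predicate the first \<open>N\<close> variables of the defining formula hold parameters.
  Bound variables follow de Bruijn's convention: a quantifier makes the new element entry \<open>0\<close> of
  the environment and shifts the other entries by one.\<close>

definition definable_pred ::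
    "('a \<Rightarrow> 'a \<Rightarrow> bool) \<Rightarrow> ((nat \<Rightarrow> 'a) \<Rightarrow> bool) \<Rightarrow> bool" where
  "definable_pred E P \<longleftrightarrow>
     (\<exists>\<phi> N p. \<forall>e. P e \<longleftrightarrow> sat E (\<lambda>i. if i < N then p i else e (i - N)) \<phi>)"

context ZFA_model
begin

abbreviation dfn :: "((nat \<Rightarrow> 'a) \<Rightarrow> bool) \<Rightarrow> bool" where
  "dfn \<equiv> definable_pred E"

text \<open>The language has no function symbols, so a term counts as definable when its graph
  is.\<close>

definition dft :: "((nat \<Rightarrow> 'a) \<Rightarrow> 'a) \<Rightarrow> bool" where
  "dft t \<longleftrightarrow> dfn (\<lambda>e. e 0 = t (\<lambda>i. e (Suc i)))"

lemma dfn_rename: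
  assumes "dfn P" "inj \<rho>"
  shows "dfn (\<lambda>e. P (\<lambda>i. e (\<rho> i)))"
proof -
  obtain \<phi> N p where P: "\<And>e. P e \<longleftrightarrow> sat E (\<lambda>i. if i < N then p i else e (i - N)) \<phi>"
    using assms(1) unfolding definable_pred_def by blast
  define \<sigma> where "\<sigma> i = (if i < N then i else N + \<rho> (i - N))" for i
  have \<sigma>: "inj \<sigma>"
    unfolding \<sigma>_def inj_def using injD[OF assms(2)] by (metis add_left_imp_eq diff_add_inverse
      le_add1 le_add_diff_inverse not_less)
  have "P (\<lambda>i. e (\<rho> i)) \<longleftrightarrow> sat E (\<lambda>i. if i < N then p i else e (i - N)) (rename \<sigma> \<phi>)" for e
    unfolding sat_rename[OF \<sigma>] P
    by (rule arg_cong[where f = "\<lambda>e. sat E e \<phi>"]) (auto simp: \<sigma>_def)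
  then show ?thesis unfolding definable_pred_def by blast
qed

lemma dfn_not:
  assumes "dfn P"
  shows "dfn (\<lambda>e. \<not> P e)"
proof -
  obtain \<phi> N p where "\<And>e. P e \<longleftrightarrow> sat E (\<lambda>i. if i < N then p i else e (i - N)) \<phi>"
    using assms unfolding definable_pred_def by blast
  then have "\<not> P e \<longleftrightarrow> sat E (\<lambda>i. if i < N then p i else e (i - N)) (Neg \<phi>)" for e
    by simp
  then show ?thesis unfolding definable_pred_def by blast
qed

lemma dfn_conj:
  assumes "dfn P" "dfn Q"
  shows "dfn (\<lambda>e. P e \<and> Q e)"
proof -
  obtain \<phi> N p where P: "\<And>e. P e \<longleftrightarrow> sat E (\<lambda>i. if i < N then p i else e (i - N)) \<phi>"
    using assms(1) unfolding definable_pred_def by blast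
  obtain \<psi> M q where Q: "\<And>e. Q e \<longleftrightarrow> sat E (\<lambda>i. if i < M then q i else e (i - M)) \<psi>"
    using assms(2) unfolding definable_pred_def by blast
  \<comment> \<open>The two parameter lists are placed side by side, those of \<open>\<phi>\<close>
    first; \<open>\<sigma>\<close> and \<open>\<tau>\<close> move each formula to its own block and
    to the common environment behind both.\<close>
  define \<sigma> where "\<sigma> i = (if i < N then i else i + M)" for i
  define \<tau> where "\<tau> i = i + N" for i
  have \<sigma>: "inj \<sigma>" and \<tau>: "inj \<tau>"
    unfolding \<sigma>_def \<tau>_def inj_def by auto
  define s where "s i = (if i < N then p i else q (i - N))" for i
  have "P e \<and> Q e \<longleftrightarrow> sat E (\<lambda>i. if i < N + M then s i else e (i - (N + M)))
      (Conj (rename \<sigma> \<phi>) (rename \<tau> \<psi>))" for e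
    unfolding sat.simps sat_rename[OF \<sigma>] sat_rename[OF \<tau>] P Q
    by (intro arg_cong2[where f = "(\<and>)"] arg_cong[where f = "\<lambda>e. sat E e _"])
      (auto simp: \<sigma>_def \<tau>_def s_def fun_eq_iff add.commute)
  then show ?thesis unfolding definable_pred_def by blast
qed

lemma dfn_all:
  assumes "dfn (\<lambda>e. Q (\<lambda>i. e (Suc i)) (e 0))"
  shows "dfn (\<lambda>e. \<forall>x. Q e x)"
proof -
  obtain \<phi> N p where Q: "\<And>e. Q (\<lambda>i. e (Suc i)) (e 0) \<longleftrightarrow>
      sat E (\<lambda>i. if i < N then p i else e (i - N)) \<phi>"
    using assms unfolding definable_pred_def by blast
  define M where "M = N + max_var \<phi>"
  \<comment> \<open>\<open>\<sigma>\<close> cycles the indices from \<open>N\<close> to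
    \<open>M\<close>: the de Bruijn entry \<open>N\<close> becomes the quantified variable
    \<open>M\<close>, the later ones drop by one. Lowering all later indices would leave no index
    for the quantified variable; as \<open>\<phi>\<close> has no variable above
    \<open>max_var \<phi>\<close>, the shift may stop at \<open>M\<close>.\<close>
  define \<sigma> where "\<sigma> i = (if i < N then i else if i = N then M else if i \<le> M then i - 1 else i)"
    for i
  have \<sigma>: "inj \<sigma>" unfolding inj_def \<sigma>_def M_def by auto
  have "Q e x \<longleftrightarrow>
      sat E ((\<lambda>i. if i < N then p i else e (i - N))(M := x)) (rename \<sigma> \<phi>)" for e x
  proof -
    have "Q e x \<longleftrightarrow> sat E (\<lambda>i. if i < N then p i else case_nat x e (i - N)) \<phi>"
      using Q[of "case_nat x e"] by simp
    also have "\<dots> \<longleftrightarrow>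
        sat E ((\<lambda>i. if i < N then p i else e (i - N))(M := x)) (rename \<sigma> \<phi>)"
      unfolding sat_rename[OF \<sigma>]
    proof (rule sat_cong)
      fix i
      assume "i \<le> max_var \<phi>"
      then have "i \<le> M" by (simp add: M_def)
      consider "i < N" | "i = N" | j where "i = N + Suc j"
        by (metis add_Suc_right less_imp_Suc_add linorder_neqE_nat)
      then show "(if i < N then p i else case_nat x e (i - N)) =
          ((\<lambda>i. if i < N then p i else e (i - N))(M := x)) (\<sigma> i)"
        using \<open>i \<le> M\<close> by cases (auto simp: \<sigma>_def M_def)
    qed
    finally show ?thesis .
  qed
  then have "(\<forall>x. Q e x) \<longleftrightarrow>
      sat E (\<lambda>i. if i < N then p i else e (i - N)) (All M (rename \<sigma> \<phi>))" for e
    by simp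
  then show ?thesis unfolding definable_pred_def by blast
qed

lemma dfn_disj:
  assumes "dfn P" "dfn Q"
  shows "dfn (\<lambda>e. P e \<or> Q e)"
  using dfn_not[OF dfn_conj[OF dfn_not[OF assms(1)] dfn_not[OF assms(2)]]] by simp

lemma dfn_imp:
  assumes "dfn P" "dfn Q"
  shows "dfn (\<lambda>e. P e \<longrightarrow> Q e)"
  using dfn_disj[OF dfn_not[OF assms(1)] assms(2)] by simp

lemma dfn_iff:
  assumes "dfn P" "dfn Q"
  shows "dfn (\<lambda>e. P e \<longleftrightarrow> Q e)"
  unfolding iff_conv_conj_imp using dfn_conj[OF dfn_imp[OF assms] dfn_imp[OF assms(2,1)]] .

lemma dfn_ex:
  assumes "dfn (\<lambda>e. Q (\<lambda>i. e (Suc i)) (e 0))"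
  shows "dfn (\<lambda>e. \<exists>x. Q e x)"
  using dfn_not[OF dfn_all[of "\<lambda>e x. \<not> Q e x", OF dfn_not[OF assms]]]
  unfolding not_all not_not .

lemma dfn_E_var: "dfn (\<lambda>e. E (e i) (e j))"
  unfolding definable_pred_def by (rule exI[of _ "Mem i j"], rule exI[of _ 0]) simp

lemma dfn_eq_var: "dfn (\<lambda>e. e i = e j)"
  unfolding definable_pred_def by (rule exI[of _ "Eq i j"], rule exI[of _ 0]) simp

lemma dft_const: "dft (\<lambda>e. c)"
  unfolding dft_def definable_pred_def
  by (rule exI[of _ "Eq 1 0"], rule exI[of _ 1], rule exI[of _ "\<lambda>_. c"]) simp

lemma dft_var: "dft (\<lambda>e. e i)"
  unfolding dft_def by (rule dfn_eq_var)

lemma dft_shift: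
  assumes "dft t"
  shows "dft (\<lambda>e. t (\<lambda>i. e (Suc i)))"
proof -
  have "inj (case_nat 0 (\<lambda>i. Suc (Suc i)))"
    by (auto simp: inj_def split: nat.splits)
  from dfn_rename[OF assms[unfolded dft_def] this] show ?thesis
    unfolding dft_def by simp
qed

text \<open>Substitution is expressed by quantifying over the value of the term: some
  \<open>x\<close> equals \<open>t e\<close> and satisfies \<open>Q e\<close>.\<close>

lemma dfn_subst:
  assumes "dfn (\<lambda>e. Q (\<lambda>i. e (Suc i)) (e 0))" "dft t"
  shows "dfn (\<lambda>e. Q e (t e))"
  using dfn_ex[of "\<lambda>e x. x = t e \<and> Q e x", OF dfn_conj[OF assms(2)[unfolded dft_def] assms(1)]]
  by simp

lemma dfn_E:
  assumes "dft t" "dft s"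
  shows "dfn (\<lambda>e. E (t e) (s e))"
  by (rule dfn_subst[of "\<lambda>e x. E x (s e)", OF _ assms(1)], rule dfn_subst[of "\<lambda>e. E (e 0)", OF dfn_E_var dft_shift[OF assms(2)]])

lemma dfn_eq:
  assumes "dft t" "dft s"
  shows "dfn (\<lambda>e. t e = s e)"
  by (rule dfn_subst[of "\<lambda>e x. x = s e", OF _ assms(1)], rule dfn_subst[of "\<lambda>e. (=) (e 0)", OF dfn_eq_var dft_shift[OF assms(2)]])

lemma dft_comp:
  assumes "dft (\<lambda>e. F (e 0))" "dft t"
  shows "dft (\<lambda>e. F (t e))"
proof -
  \<comment> \<open>The graph of \<open>F\<close> lists the value before the argument; the
    transposition puts the argument at entry 0, where \<open>dfn_subst\<close> substitutes.\<close>
  have "inj (\<lambda>i::nat. if i = 0 then Suc 0 else if i = 1 then 0 else i)"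
    by (auto simp: inj_def)
  from dfn_rename[OF assms(1)[unfolded dft_def] this]
  have F: "dfn (\<lambda>e. e (Suc 0) = F (e 0))" by simp
  show ?thesis
    unfolding dft_def by (rule dfn_subst[OF F dft_shift[OF assms(2)]])
qed

section \<open>Classes that are sets of the model\<close>

definition small :: "('a \<Rightarrow> bool) \<Rightarrow> bool" where
  "small P \<longleftrightarrow> (\<exists>y. \<forall>z. E z y \<longleftrightarrow> P z)"

definition coll :: "('a \<Rightarrow> bool) \<Rightarrow> 'a" where
  "coll P = (THE y. \<forall>z. E z y \<longleftrightarrow> P z)"

text \<open>This replaces the description operator by a statement about membership only, which is
  how \<open>dft_coll\<close> obtains definable terms.\<close>

lemma eq_coll_iff:
  assumes "small P"
  shows "y = coll P \<longleftrightarrow> (\<forall>z. E z y \<longleftrightarrow> P z)"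
proof -
  have "\<exists>!y. \<forall>z. E z y \<longleftrightarrow> P z"
    using assms extensionality unfolding small_def by metis
  from theI'[OF this] show ?thesis
    unfolding coll_def[symmetric] using extensionality by metis
qed

lemma E_coll: "small P \<Longrightarrow> E z (coll P) \<longleftrightarrow> P z"
  using eq_coll_iff by blast

lemma dft_coll:
  assumes "\<And>e. small (P e)" "dfn (\<lambda>e. P (\<lambda>i. e (Suc i)) (e 0))"
  shows "dft (\<lambda>e. coll (P e))"
proof -
  have "inj (case_nat 0 (\<lambda>i. Suc (Suc i)))"
    by (auto simp: inj_def split: nat.splits)
  from dfn_rename[OF assms(2) this]
  have "dfn (\<lambda>e. P (\<lambda>i. e (Suc (Suc i))) (e 0))" by simp
  then show ?thesis
    unfolding dft_def eq_coll_iff[OF assms(1)]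
    by (intro dfn_all dfn_iff dfn_E_var)
qed

lemma small_sep:
  assumes "dfn (\<lambda>e. P (e 0))"
  shows "small (\<lambda>x. E x a \<and> P x)"
proof -
  obtain \<phi> N p where P: "\<And>e. P (e 0) \<longleftrightarrow> sat E (\<lambda>i. if i < N then p i else e (i - N)) \<phi>"
    using assms unfolding definable_pred_def by blast
  \<comment> \<open>The separation schema keeps variable 0 for the element, whereas
    \<open>definable_pred\<close> puts the parameters first. So the element moves from
    \<open>N\<close> to 0 and the parameters move up by one; \<open>a\<close> merely fills the
    remaining entries.\<close>
  define \<sigma> where "\<sigma> i = (if i < N then Suc i else if i = N then 0 else i)" for i
  have \<sigma>: "inj \<sigma>" unfolding inj_def \<sigma>_def by auto
  define e where "e i = (if i \<le> N then p (i - 1) else a)" for i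
  have "P x \<longleftrightarrow> sat E (e(0 := x)) (rename \<sigma> \<phi>)" for x
  proof -
    have "P x \<longleftrightarrow> sat E (\<lambda>i. if i < N then p i else case_nat x (\<lambda>_. a) (i - N)) \<phi>"
      using P[of "case_nat x (\<lambda>_. a)"] by simp
    also have "\<dots> \<longleftrightarrow> sat E (e(0 := x)) (rename \<sigma> \<phi>)"
      unfolding sat_rename[OF \<sigma>]
      by (rule arg_cong[where f = "\<lambda>e. sat E e \<phi>"])
        (auto simp: \<sigma>_def e_def fun_eq_iff split: nat.splits)
    finally show ?thesis .
  qed
  then show ?thesis
    using separation[of a e "rename \<sigma> \<phi>"] unfolding small_def by simp
qed

lemma small_subset:
  assumes "dfn (\<lambda>e. P (e 0))" "\<And>x. P x \<Longrightarrow> E x a"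
  shows "small P"
proof -
  have "P = (\<lambda>x. E x a \<and> P x)" using assms(2) by blast
  then show ?thesis using small_sep[OF assms(1), of a] by simp
qed

lemma small_image:
  assumes "dft (\<lambda>e. F (e 0))"
  shows "small (\<lambda>y. \<exists>x. E x a \<and> y = F x)"
proof -
  obtain \<phi> N p where P: "\<And>e. e 0 = F (e (Suc 0)) \<longleftrightarrow>
      sat E (\<lambda>i. if i < N then p i else e (i - N)) \<phi>"
    using assms unfolding dft_def definable_pred_def by blast
  \<comment> \<open>In the replacement schema variable 0 is the argument and 1 the value, while here
    the value (entry \<open>N\<close>) precedes the argument (entry \<open>Suc N\<close>). The two
    are exchanged in front of the parameters.\<close>
  define \<sigma> where "\<sigma> i =
    (if i < N then i + 2 else if i = N then 1 else if i = Suc N then 0 else i)" for i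
  have \<sigma>: "inj \<sigma>" unfolding inj_def \<sigma>_def by auto
  define e where "e i = (if i < N + 2 then p (i - 2) else a)" for i
  have "y = F x \<longleftrightarrow> sat E (e(0 := x, 1 := y)) (rename \<sigma> \<phi>)" for x y
  proof -
    have "y = F x \<longleftrightarrow>
        sat E (\<lambda>i. if i < N then p i else case_nat y (case_nat x (\<lambda>_. a)) (i - N)) \<phi>"
      using P[of "case_nat y (case_nat x (\<lambda>_. a))"] by simp
    also have "\<dots> \<longleftrightarrow> sat E (e(0 := x, 1 := y)) (rename \<sigma> \<phi>)"
      unfolding sat_rename[OF \<sigma>]
      by (rule arg_cong[where f = "\<lambda>e. sat E e \<phi>"])
        (auto simp: \<sigma>_def e_def fun_eq_iff split: nat.splits)
    finally show ?thesis .
  qed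
  note eq = this
  show ?thesis
    using replacement[of a e "rename \<sigma> \<phi>"] unfolding small_def eq[symmetric] by simp
qed

lemma small_upair: "small (\<lambda>z. z = a \<or> z = b)"
  using pairing[of a b] unfolding small_def is_upair_def .

lemma small_union: "small (\<lambda>z. \<exists>y. E y a \<and> E z y)"
  using union unfolding small_def .

lemma small_empty: "small (\<lambda>z. False)"
  using infinity unfolding small_def by blast

lemma small_disj:
  assumes "small P" "small Q"
  shows "small (\<lambda>z. P z \<or> Q z)"
proof -
  obtain a b where ab: "\<And>z. E z a \<longleftrightarrow> P z" "\<And>z. E z b \<longleftrightarrow> Q z"
    using assms unfolding small_def by blast
  obtain p where "\<And>z. E z p \<longleftrightarrow> z = a \<or> z = b"
    using small_upair unfolding small_def by blast
  then show ?thesis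
    using small_union[of p] ab unfolding small_def by metis
qed

lemma small_singleton: "small (\<lambda>z. z = a)"
  using small_upair[of a a] by simp

lemma small_E: "small (\<lambda>z. E z a)"
  unfolding small_def by blast

lemma small_UN:
  assumes P: "\<And>x. E x a \<Longrightarrow> small (P x)" and "dfn (\<lambda>e. P (e (Suc 0)) (e 0))"
  shows "small (\<lambda>z. \<exists>x. E x a \<and> P x z)"
proof -
  \<comment> \<open>Outside \<open>a\<close> the guarded class is empty, so \<open>coll\<close> of
    it is a total definable term, to which replacement applies before the union is taken.\<close>
  have small: "small (\<lambda>z. E x a \<and> P x z)" for x
    using P[of x] small_empty by (cases "E x a") simp_all
  have "dft (\<lambda>e. coll (\<lambda>z. E (e 0) a \<and> P (e 0) z))"
    by (rule dft_coll, rule small) (intro dfn_conj dfn_E dft_var dft_const assms(2))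
  from small_image[OF this] obtain Y
    where Y: "\<And>y. E y Y \<longleftrightarrow> (\<exists>x. E x a \<and> y = coll (\<lambda>z. E x a \<and> P x z))"
    unfolding small_def by blast
  have "(\<exists>y. E y Y \<and> E z y) \<longleftrightarrow> (\<exists>x. E x a \<and> P x z)" for z
    unfolding Y using E_coll[OF small] by metis
  then show ?thesis using small_union[of Y] by simp
qed

section \<open>Set operations of the model and their definability\<close>

definition zero :: 'a where "zero = coll (\<lambda>z. False)"
definition upair :: "'a \<Rightarrow> 'a \<Rightarrow> 'a" where "upair a b = coll (\<lambda>z. z = a \<or> z = b)"
definition opair :: "'a \<Rightarrow> 'a \<Rightarrow> 'a" where "opair a b = upair (upair a a) (upair a b)"
definition bigunion :: "'a \<Rightarrow> 'a" where "bigunion a = coll (\<lambda>z. \<exists>y. E y a \<and> E z y)"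
definition succ :: "'a \<Rightarrow> 'a" where "succ a = coll (\<lambda>z. E z a \<or> z = a)"

lemma E_zero [simp]: "\<not> E z zero"
  unfolding zero_def E_coll[OF small_empty] by simp

lemma E_upair [simp]: "E z (upair a b) \<longleftrightarrow> z = a \<or> z = b"
  unfolding upair_def E_coll[OF small_upair] by simp

lemma E_bigunion [simp]: "E z (bigunion a) \<longleftrightarrow> (\<exists>y. E y a \<and> E z y)"
  unfolding bigunion_def E_coll[OF small_union] by simp

lemma small_succ: "small (\<lambda>z. E z a \<or> z = a)"
  by (intro small_disj small_E small_singleton)

lemma E_succ [simp]: "E z (succ a) \<longleftrightarrow> E z a \<or> z = a"
  unfolding succ_def E_coll[OF small_succ] by simp

lemma upair_eq_iff [simp]:
  "upair a b = upair c d \<longleftrightarrow> a = c \<and> b = d \<or> a = d \<and> b = c"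
proof
  assume "upair a b = upair c d"
  then have "z = a \<or> z = b \<longleftrightarrow> z = c \<or> z = d" for z
    by (metis E_upair)
  then show "a = c \<and> b = d \<or> a = d \<and> b = c" by metis
next
  assume "a = c \<and> b = d \<or> a = d \<and> b = c"
  then show "upair a b = upair c d"
    by (intro extensionality) auto
qed

lemma opair_eq_iff [simp]: "opair a b = opair c d \<longleftrightarrow> a = c \<and> b = d"
  unfolding opair_def by auto

lemma is_upair_iff: "is_upair E p a b \<longleftrightarrow> p = upair a b"
  unfolding is_upair_def upair_def eq_coll_iff[OF small_upair] ..

lemma is_opair_iff: "is_opair E p a b \<longleftrightarrow> p = opair a b"
  unfolding is_opair_def is_upair_iff opair_def by simp

lemma pair_in_iff: "pair_in E r x y \<longleftrightarrow> E (opair x y) r"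
  unfolding pair_in_def is_opair_iff by simp

lemma dft_upair:
  assumes "dft s" "dft t"
  shows "dft (\<lambda>e. upair (s e) (t e))"
  unfolding upair_def
  by (intro dft_coll small_upair dfn_disj dfn_eq dft_var dft_shift[OF assms(1)]
      dft_shift[OF assms(2)])

lemma dft_opair: "dft s \<Longrightarrow> dft t \<Longrightarrow> dft (\<lambda>e. opair (s e) (t e))"
  unfolding opair_def by (intro dft_upair)

lemma dft_succ:
  assumes "dft t"
  shows "dft (\<lambda>e. succ (t e))"
  unfolding succ_def
  by (intro dft_coll small_succ dfn_disj dfn_eq dfn_E dft_var dft_shift[OF assms])

lemma dft_bigunion: "dft (\<lambda>e. bigunion (e 0))"
  unfolding bigunion_def by (intro dft_coll small_union dfn_ex dfn_conj dfn_E dft_var)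

lemmas dfn_intros = dfn_not dfn_conj dfn_disj dfn_imp dfn_iff dfn_all dfn_ex dfn_E dfn_eq
  dft_const dft_var dft_upair dft_opair dft_succ

section \<open>Transitive supersets\<close>

text \<open>The intersection of all inductive sets. Induction covers definable predicates only,
  since a metatheoretic subset of \<open>w\<close> need not be a set of the model, whose natural
  numbers may be nonstandard.\<close>

lemma omega_exists:
  obtains w where "E zero w" "\<And>n. E n w \<Longrightarrow> E (succ n) w"
    "\<And>P n. dfn (\<lambda>e. P (e 0)) \<Longrightarrow> P zero \<Longrightarrow> (\<And>n. P n \<Longrightarrow> P (succ n)) \<Longrightarrow> E n w \<Longrightarrow> P n"
proof -
  define ind where "ind J \<longleftrightarrow> E zero J \<and> (\<forall>n. E n J \<longrightarrow> E (succ n) J)" for J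
  have "\<exists>I. ind I"
  proof -
    obtain I z where "\<forall>x. \<not> E x z" "E z I"
      "\<forall>x. E x I \<longrightarrow> (\<exists>s. (\<forall>z. E z s \<longleftrightarrow> E z x \<or> z = x) \<and> E s I)"
      using infinity by blast
    moreover from this have "z = zero" by (intro extensionality) simp
    moreover have "s = succ x" if "\<forall>z. E z s \<longleftrightarrow> E z x \<or> z = x" for s x
      using that by (intro extensionality) simp
    ultimately show ?thesis unfolding ind_def by metis
  qed
  then obtain I where I: "ind I" ..
  have "small (\<lambda>n. E n I \<and> (\<forall>J. ind J \<longrightarrow> E n J))"
    unfolding ind_def by (rule small_sep) (intro dfn_intros)
  then obtain w where w: "\<And>n. E n w \<longleftrightarrow> E n I \<and> (\<forall>J. ind J \<longrightarrow> E n J)"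
    unfolding small_def by blast
  show ?thesis
  proof
    show "E zero w" "\<And>n. E n w \<Longrightarrow> E (succ n) w"
      using I unfolding w ind_def by blast+
    then have "ind w" unfolding ind_def by blast
    fix P n
    assume P: "dfn (\<lambda>e. P (e 0))" "P zero" "\<And>n. P n \<Longrightarrow> P (succ n)" and n: "E n w"
    obtain J where J: "\<And>n. E n J \<longleftrightarrow> E n w \<and> P n"
      using small_sep[OF P(1)] unfolding small_def by blast
    have "ind J" using P(2,3) \<open>ind w\<close> unfolding ind_def J by blast
    then have "E n J" using n w by blast
    then show "P n" using J by blast
  qed
qed

text \<open>The stages of the recursion are only shown to form a set for each index, not to be single
  elements; this avoids the injectivity of \<open>succ\<close>, which needs an argument without foundation.\<close>

lemma closed_set_exists:
  assumes F: "dft (\<lambda>e. F (e 0))"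
  obtains U where "E a U" "\<And>y. E y U \<Longrightarrow> E (F y) U"
proof -
  obtain w where w: "E zero w" "\<And>n. E n w \<Longrightarrow> E (succ n) w" and
    induct: "\<And>P n. dfn (\<lambda>e. P (e 0)) \<Longrightarrow> P zero \<Longrightarrow> (\<And>n. P n \<Longrightarrow> P (succ n)) \<Longrightarrow> E n w \<Longrightarrow> P n"
    using omega_exists by metis
  \<comment> \<open>A good \<open>g\<close> is a partial record of iterating \<open>F\<close> from
    \<open>a\<close>: each entry is the initial one or is justified by an earlier entry of
    \<open>g\<close>.\<close>
  define good where "good g \<longleftrightarrow> (\<forall>n y. E (opair n y) g \<longrightarrow> n = zero \<and> y = a \<or>
    (\<exists>k x. n = succ k \<and> y = F x \<and> E (opair k x) g))" for g
  define stage where "stage n y \<longleftrightarrow> (\<exists>g. good g \<and> E (opair n y) g)" for n y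
  note dfn_intros' = dfn_intros dft_comp[OF F]
  have dfn_stage: "dfn (\<lambda>e. stage (e (Suc 0)) (e 0))"
    unfolding stage_def good_def by (intro dfn_intros')
  have stage_zero: "stage zero a"
    unfolding stage_def good_def by (rule exI[of _ "upair (opair zero a) (opair zero a)"]) simp
  have stage_succ: "stage (succ n) (F y)" if st: "stage n y" for n y
  proof -
    obtain g where g: "good g" "E (opair n y) g" using st unfolding stage_def by blast
    obtain h where h: "\<And>z. E z h \<longleftrightarrow> E z g \<or> z = opair (succ n) (F y)"
      using small_disj[OF small_E small_singleton] unfolding small_def by metis
    have "good h" using g unfolding good_def h by (metis opair_eq_iff)
    then show ?thesis unfolding stage_def using h by blast
  qed
  have stage_cases: "n = zero \<and> y = a \<or> (\<exists>k x. n = succ k \<and> y = F x \<and> stage k x)"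
    if "stage n y" for n y
    using that unfolding stage_def good_def by metis
  \<comment> \<open>Any \<open>k\<close> with \<open>n = succ k\<close> is a member of
    \<open>n\<close>. Hence stage \<open>n\<close> is contained in \<open>a\<close> together with
    the \<open>F\<close>-image of the union of the stages at members of \<open>n\<close>, and no
    predecessor has to be singled out.\<close>
  have step: "small (stage n)" if k: "\<And>k. E k n \<Longrightarrow> small (stage k)" for n
  proof -
    obtain Y where Y: "\<And>x. E x Y \<longleftrightarrow> (\<exists>k. E k n \<and> stage k x)"
      using small_UN[OF k dfn_stage] unfolding small_def by metis
    obtain W where W: "\<And>y. E y W \<longleftrightarrow> (\<exists>x. E x Y \<and> y = F x) \<or> y = a"
      using small_disj[OF small_image[OF F] small_singleton] unfolding small_def by metis
    show ?thesis
    proof (rule small_subset)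
      show "dfn (\<lambda>e. stage n (e 0))"
        unfolding stage_def good_def by (intro dfn_intros')
      show "E y W" if "stage n y" for y
        using stage_cases[OF that] unfolding W Y by fastforce
    qed
  qed
  have all_small: "small (stage n)" if "E n w" for n
  proof -
    \<comment> \<open>The claim is strengthened to all members of \<open>succ n\<close>, because
      \<open>step\<close> asks for smallness at every member of its index.\<close>
    have "\<forall>k. E k (succ n) \<longrightarrow> small (stage k)"
    proof (rule induct[OF _ _ _ that])
      show "dfn (\<lambda>e. \<forall>k. E k (succ (e 0)) \<longrightarrow> small (stage k))"
        unfolding small_def stage_def good_def by (intro dfn_intros')
      show "\<forall>k. E k (succ zero) \<longrightarrow> small (stage k)"
        using step[of zero] by simp
      show "\<forall>k. E k (succ (succ n)) \<longrightarrow> small (stage k)"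
        if "\<forall>k. E k (succ n) \<longrightarrow> small (stage k)" for n
        using that step[of "succ n"] by (metis E_succ)
    qed
    then show ?thesis by simp
  qed
  obtain U where U: "\<And>x. E x U \<longleftrightarrow> (\<exists>k. E k w \<and> stage k x)"
    using small_UN[OF all_small dfn_stage] unfolding small_def by metis
  show ?thesis
    by (rule that[of U]) (use U w stage_zero stage_succ in blast)+
qed

text \<open>The singleton map is injective and misses the empty set.\<close>

lemma infinite_universe: "infinite (UNIV :: 'a set)"
proof
  assume "finite (UNIV :: 'a set)"
  moreover have "inj (\<lambda>a. upair a a)" by (auto simp: inj_def)
  ultimately have "surj (\<lambda>a. upair a a)" by (rule finite_UNIV_inj_surj)
  then obtain a where "zero = upair a a" by blast
  then show False using E_zero[of a] by simp
qed

text \<open>Take \<open>U\<close> containing the singleton of \<open>a\<close> and closed under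
  unions of its members. Its union is transitive: if \<open>y\<close> belongs to \<open>u\<close> in
  \<open>U\<close>, the elements of \<open>y\<close> belong to \<open>bigunion u\<close>, again in
  \<open>U\<close>.\<close>

lemma transitive_superset_exists:
  obtains t where "E a t" "\<And>x y. E y t \<Longrightarrow> E x y \<Longrightarrow> E x t"
proof -
  obtain U where U: "E (upair a a) U" "\<And>y. E y U \<Longrightarrow> E (bigunion y) U"
    using closed_set_exists[OF dft_bigunion, of "upair a a"] by metis
  show ?thesis
    by (rule that[of "bigunion U"]) (use U in \<open>force, fastforce\<close>)
qed

text \<open>Ordered pairs over \<open>a\<close> lie in the double power set of \<open>a\<close>, so
  separation suffices.\<close>

lemma relation_exists:
  assumes "dfn (\<lambda>e. P (e (Suc 0)) (e 0))"
  shows "\<exists>r. \<forall>p. E p r \<longleftrightarrow> (\<exists>x y. E x a \<and> E y a \<and> P x y \<and> p = opair x y)"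
proof -
  obtain q where q: "\<And>z. E z q \<longleftrightarrow> (\<forall>w. E w z \<longrightarrow> E w a)"
    using power_set by blast
  obtain q' where q': "\<And>z. E z q' \<longleftrightarrow> (\<forall>w. E w z \<longrightarrow> E w q)"
    using power_set by blast
  have "small (\<lambda>p. \<exists>x y. E x a \<and> E y a \<and> P x y \<and> p = opair x y)"
  proof (rule small_subset)
    show "dfn (\<lambda>e. \<exists>x y. E x a \<and> E y a \<and> P x y \<and> e 0 = opair x y)"
      by (intro dfn_intros) (rule assms)
    show "E p q'" if "\<exists>x y. E x a \<and> E y a \<and> P x y \<and> p = opair x y" for p
      using that unfolding q' q opair_def by auto
  qed
  then show ?thesis unfolding small_def .
qed

section \<open>Components of the D-graph inside graphs of the model\<close>

lemma D_component_in_graph: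
  assumes C: "C \<in> components (D_graph E)"
  shows "\<exists>d r. is_graph_in E d r \<and> (\<exists>K \<in> components (graph_of E d r). C \<simeq> K)"
proof -
  let ?D = "{(x, y). E x y \<and> E y x}"
  obtain a where a: "C = (?D\<^sup>* `` {a}, Restr ?D (?D\<^sup>* `` {a}))"
    using C unfolding components_eq D_graph_def by (auto simp: Let_def)
  obtain t where t: "E a t" "\<And>x y. E y t \<Longrightarrow> E x y \<Longrightarrow> E x t"
    using transitive_superset_exists by metis
  have "dfn (\<lambda>e. E (e (Suc 0)) (e 0) \<and> E (e 0) (e (Suc 0)))"
    by (intro dfn_intros)
  from relation_exists[of "\<lambda>x y. E x y \<and> E y x", OF this] obtain r where r:
    "\<And>p. E p r \<longleftrightarrow> (\<exists>x y. E x t \<and> E y t \<and> (E x y \<and> E y x) \<and> p = opair x y)"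
    by blast
  let ?R = "{(x, y). pair_in E r x y}"
  have R: "pair_in E r x y \<longleftrightarrow> E x t \<and> E y t \<and> E x y \<and> E y x" for x y
    unfolding pair_in_iff r by auto
  have "is_graph_in E t r"
    unfolding is_graph_in_def R is_opair_iff r by blast
  moreover have "(?R\<^sup>* `` {a}, Restr ?R (?R\<^sup>* `` {a})) \<in> components (graph_of E t r)"
    unfolding components_eq graph_of_def using t(1) by (auto simp: Let_def)
  moreover have "(?R\<^sup>* `` {a}, Restr ?R (?R\<^sup>* `` {a})) \<simeq> C"
    unfolding a
  \<comment> \<open>The embedding is the identity; transitivity of \<open>t\<close> puts every
    \<open>D\<close>-neighbour of a point of \<open>t\<close> into \<open>t\<close>.\<close>
  proof (rule component_iso_embedding[of ?R "{x. E x t}" a "\<lambda>x. x"])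
    show "(v, z) \<in> ?D \<longleftrightarrow> (\<exists>w. (v, w) \<in> ?R \<and> z = w)" if "v \<in> {x. E x t}" for v z
      using that t(2) by (auto simp: R)
  qed (use t(1) in \<open>auto simp: R\<close>)
  ultimately show ?thesis using graph_iso_sym by blast
qed

section \<open>Copies of graphs inside the D-graph\<close>

definition tag :: "'a \<Rightarrow> 'a \<Rightarrow> 'a" where
  "tag c v = (let s = opair c v; t = upair s s in upair t t)"

lemma tag_eq_iff [simp]: "tag c v = tag c' v' \<longleftrightarrow> c = c' \<and> v = v'"
  unfolding tag_def Let_def by auto

lemma zero_neq_opair: "zero \<noteq> opair c v"
  unfolding opair_def by (metis E_upair E_zero)

text \<open>All values of the later solution contain \<open>zero\<close>. Thus this lemma keeps tags
  from being such values, and the next one keeps such values from being elements of tags.\<close>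

lemma zero_notin_tag: "\<not> E zero (tag c v)"
  unfolding tag_def Let_def by (metis E_upair E_zero)

lemma zero_notin_elem_tag: "E x (tag c v) \<Longrightarrow> \<not> E zero x"
  unfolding tag_def Let_def using zero_neq_opair by auto

lemma dft_tag: "dft t \<Longrightarrow> dft (\<lambda>e. tag c (t e))"
  unfolding tag_def Let_def by (intro dft_upair dft_opair dft_const)

text \<open>The indeterminate for \<open>v\<close> contains \<open>zero\<close>, hence is neither \<open>zero\<close> nor a tag, so that these
  are not mistaken for indeterminates.\<close>

definition indet :: "'a \<Rightarrow> 'a" where
  "indet v = upair zero (upair v v)"

lemma indet_eq_iff [simp]: "indet v = indet w \<longleftrightarrow> v = w"
  unfolding indet_def by (metis E_upair E_zero upair_eq_iff)

lemma zero_in_indet: "E zero (indet v)"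
  unfolding indet_def by simp

lemma dft_indet: "dft t \<Longrightarrow> dft (\<lambda>e. indet (t e))"
  unfolding indet_def by (intro dft_upair dft_const)

lemma graph_edge:
  assumes "is_graph_in E d r" "pair_in E r v w"
  shows "E v d" "E w d" "pair_in E r w v"
proof -
  obtain x y where "E x d" "E y d" "opair v w = opair x y"
    using assms unfolding is_graph_in_def pair_in_iff is_opair_iff by blast
  then show "E v d" "E w d" by simp_all
  show "pair_in E r w v" using assms unfolding is_graph_in_def by blast
qed

text \<open>Anti-foundation is applied to a system with one indeterminate per vertex, whose
  right-hand side holds the indeterminates of the neighbours and the constants \<open>zero\<close>
  and \<open>tag c v\<close>. A solution replaces the former by their values and keeps the
  latter.\<close>

lemma decoration_exists:
  assumes G: "is_graph_in E d r"
  obtains f where "\<And>v z. E v d \<Longrightarrow>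
    E z (f v) \<longleftrightarrow> (\<exists>w. pair_in E r v w \<and> z = f w) \<or> z = zero \<or> z = tag c v"
proof -
  note dom = graph_edge(1,2)[OF G]
  obtain X where X: "\<And>x. E x X \<longleftrightarrow> (\<exists>v. E v d \<and> x = indet v)"
    using small_image[of indet d] dft_indet[OF dft_var] unfolding small_def by metis
  obtain A where A: "\<And>x. E x A \<longleftrightarrow> (\<exists>v. E v d \<and> x = tag c v) \<or> x = zero"
    using small_disj[OF small_image[of "tag c" d] small_singleton] dft_tag[OF dft_var]
    unfolding small_def by metis
  let ?rhs = "\<lambda>v z. (\<exists>w. E (opair v w) r \<and> z = indet w) \<or> z = zero \<or> z = tag c v"
  have dfn_rhs: "dfn (\<lambda>e. ?rhs (e (Suc 0)) (e 0))"
    by (intro dfn_intros dft_indet dft_tag)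
  \<comment> \<open>Shown for every \<open>v\<close>, vertex or not, so that \<open>T\<close> is a
    total definable term.\<close>
  have small_rhs: "small (?rhs v)" for v
  proof -
    have "small (\<lambda>z. \<exists>w. E (opair v w) r \<and> z = indet w)"
    proof (rule small_subset)
      show "dfn (\<lambda>e. \<exists>w. E (opair v w) r \<and> e 0 = indet w)"
        by (intro dfn_intros dft_indet)
      show "E z X" if "\<exists>w. E (opair v w) r \<and> z = indet w" for z
        using that dom unfolding X pair_in_iff by blast
    qed
    then show ?thesis by (intro small_disj small_singleton)
  qed
  define T where "T v = coll (?rhs v)" for v
  have "dft (\<lambda>e. T (e 0))"
    unfolding T_def by (rule dft_coll[OF small_rhs dfn_rhs])
  then have "dft (\<lambda>e. opair (indet (e 0)) (T (e 0)))"
    by (intro dft_opair dft_indet dft_var)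
  from small_image[OF this] obtain S
    where S: "\<And>p. E p S \<longleftrightarrow> (\<exists>v. E v d \<and> p = opair (indet v) (T v))"
    unfolding small_def by blast
  have E_T: "E z (T v) \<longleftrightarrow> (\<exists>w. pair_in E r v w \<and> z = indet w) \<or> z = zero \<or> z = tag c v" for v z
    unfolding T_def E_coll[OF small_rhs] pair_in_iff ..
  have pair_S: "pair_in E S x s \<longleftrightarrow> (\<exists>v. E v d \<and> x = indet v \<and> s = T v)" for x s
    unfolding pair_in_iff S by simp
  have "is_flat_system E X A S"
    unfolding is_flat_system_def is_function_on_def
  proof (intro conjI allI impI)
    show "\<exists>x y. E x X \<and> is_opair E p x y" if "E p S" for p
      using that unfolding S X is_opair_iff by blast
    show "\<exists>!s. pair_in E S x s" if "E x X" for x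
      using that unfolding X pair_S by auto
    show "E z X \<or> E z A" if "E x X" "pair_in E S x s" "E z s" for x s z
    proof -
      obtain v where v: "E v d" "E z (T v)"
        using \<open>pair_in E S x s\<close> \<open>E z s\<close> unfolding pair_S by blast
      then show ?thesis
        using dom unfolding E_T X A by blast
    qed
  qed
  then obtain g where g: "is_solution E X S g"
    using anti_foundation by blast
  have ex1: "\<exists>!y. pair_in E g (indet v) y" if "E v d" for v
    using g that X unfolding is_solution_def is_function_on_def by blast
  define f where "f v = (THE y. pair_in E g (indet v) y)" for v
  have f: "pair_in E g (indet v) y \<longleftrightarrow> y = f v" if "E v d" for v y
    using theI'[OF ex1[OF that]] ex1[OF that] unfolding f_def by blast
  \<comment> \<open>The constants are not indeterminates, so the solution leaves them
    unchanged.\<close>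
  have not_X: "\<not> E zero X" "\<not> E (tag c v) X" for v
    using zero_in_indet zero_notin_tag unfolding X by (metis E_zero)+
  have indet_X: "E (indet w) X" if "pair_in E r v w" for v w
    using dom(2)[OF that] unfolding X by blast
  show ?thesis
  proof
    fix v z
    assume v: "E v d"
    have "E z (f v) \<longleftrightarrow> (\<exists>y. E y (T v) \<and> E y X \<and> pair_in E g y z) \<or> (E z (T v) \<and> \<not> E z X)"
      using g v f[OF v] unfolding is_solution_def X pair_S by blast
    also have "(\<exists>y. E y (T v) \<and> E y X \<and> pair_in E g y z) \<longleftrightarrow>
        (\<exists>w. pair_in E r v w \<and> z = f w)"
    proof -
      have "(\<exists>y. E y (T v) \<and> E y X \<and> pair_in E g y z) \<longleftrightarrow>
          (\<exists>w. pair_in E r v w \<and> pair_in E g (indet w) z)"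
        unfolding E_T using not_X indet_X by blast
      also have "\<dots> \<longleftrightarrow> (\<exists>w. pair_in E r v w \<and> z = f w)"
        using f dom by blast
      finally show ?thesis .
    qed
    also have "(E z (T v) \<and> \<not> E z X) \<longleftrightarrow> z = zero \<or> z = tag c v"
      unfolding E_T using not_X indet_X by blast
    finally show "E z (f v) \<longleftrightarrow> (\<exists>w. pair_in E r v w \<and> z = f w) \<or> z = zero \<or> z = tag c v" .
  qed
qed

text \<open>The last two properties let \<open>c\<close> be read off any single point of the copy,
  which later separates the copies for different \<open>c\<close>.\<close>

lemma graph_embedding_exists:
  assumes G: "is_graph_in E d r"
  obtains f where "inj_on f {v. E v d}"
    "\<And>v z. E v d \<Longrightarrow> E (f v) z \<and> E z (f v) \<longleftrightarrow> (\<exists>w. pair_in E r v w \<and> z = f w)"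
    "\<And>v. E v d \<Longrightarrow> E (tag c v) (f v)"
    "\<And>v b w. E v d \<Longrightarrow> E (tag b w) (f v) \<Longrightarrow> b = c"
proof -
  note dom = graph_edge(2)[OF G] and sym = graph_edge(3)[OF G]
  obtain f where f: "\<And>v z. E v d \<Longrightarrow>
    E z (f v) \<longleftrightarrow> (\<exists>w. pair_in E r v w \<and> z = f w) \<or> z = zero \<or> z = tag c v"
    using decoration_exists[OF G] by metis
  have zero: "E zero (f v)" if "E v d" for v
    using f[OF that] by simp
  \<comment> \<open>The other elements of \<open>f v\<close> are \<open>zero\<close>, which is not a
    tag, and values of \<open>f\<close>, which contain \<open>zero\<close> as no tag does.\<close>
  have tag: "b = c \<and> w = v" if v: "E v d" and mem: "E (tag b w) (f v)" for v b w
  proof -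
    have "tag b w \<noteq> zero"
      unfolding tag_def Let_def by (metis E_upair E_zero)
    moreover have "tag b w \<noteq> f u" if "pair_in E r v u" for u
      using zero[OF dom[OF that]] zero_notin_tag[of b w] by auto
    ultimately have "tag b w = tag c v"
      using mem f[OF v] by blast
    then show ?thesis by simp
  qed
  have own_tag: "E (tag c v) (f v)" if "E v d" for v
    using f[OF that] by simp
  show ?thesis
  proof
    show "inj_on f {v. E v d}"
    proof (rule inj_onI)
      fix v w
      assume "v \<in> {v. E v d}" "w \<in> {v. E v d}" "f v = f w"
      then show "v = w" using tag[of w c v] own_tag[of v] by simp
    qed
    show "E (tag c v) (f v)" if "E v d" for v
      using own_tag[OF that] .
    show "b = c" if "E v d" "E (tag b w) (f v)" for v b w
      using tag[OF that] by simp
    show "E (f v) z \<and> E z (f v) \<longleftrightarrow> (\<exists>w. pair_in E r v w \<and> z = f w)" if v: "E v d" for v z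
    proof
      assume z: "E (f v) z \<and> E z (f v)"
      have "z \<noteq> zero" using z by auto
      \<comment> \<open>Otherwise \<open>f v\<close>, which contains \<open>zero\<close>, would be
        an element of a tag.\<close>
      moreover have "z \<noteq> tag c v" using z zero[OF v] zero_notin_elem_tag by blast
      ultimately show "\<exists>w. pair_in E r v w \<and> z = f w" using z f[OF v] by blast
    next
      assume "\<exists>w. pair_in E r v w \<and> z = f w"
      then obtain w where w: "pair_in E r v w" "z = f w" by blast
      then show "E (f v) z \<and> E z (f v)"
        using f[OF v] f[OF dom[OF w(1)]] sym[OF w(1)] by blast
    qed
  qed
qed

text \<open>Every element \<open>c\<close> of the infinite universe gives its own copy of
  \<open>K\<close>, so it remains to see that the copies are distinct components.\<close>

lemma infinite_D_components:
  assumes G: "is_graph_in E d r" and K: "K \<in> components (graph_of E d r)"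
  shows "infinite {C \<in> components (D_graph E). C \<simeq> K}"
proof -
  let ?D = "{(x, y). E x y \<and> E y x}"
  let ?R = "{(x, y). pair_in E r x y}"
  obtain v where v: "E v d" and K_eq: "K = (?R\<^sup>* `` {v}, Restr ?R (?R\<^sup>* `` {v}))"
    using K unfolding components_eq graph_of_def by (auto simp: Let_def)
  have R: "?R \<subseteq> {x. E x d} \<times> {x. E x d}"
    using graph_edge(1,2)[OF G] by blast
  have "\<exists>f. inj_on f {v. E v d} \<and>
      (\<forall>v z. E v d \<longrightarrow> (E (f v) z \<and> E z (f v) \<longleftrightarrow> (\<exists>w. pair_in E r v w \<and> z = f w))) \<and>
      (\<forall>v. E v d \<longrightarrow> E (tag c v) (f v)) \<and>
      (\<forall>v b w. E v d \<longrightarrow> E (tag b w) (f v) \<longrightarrow> b = c)" for c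
    by (rule graph_embedding_exists[OF G, of c]) blast
  then obtain f where f: "\<And>c. inj_on (f c) {v. E v d}"
    "\<And>c v z. E v d \<Longrightarrow> E (f c v) z \<and> E z (f c v) \<longleftrightarrow> (\<exists>w. pair_in E r v w \<and> z = f c w)"
    "\<And>c v. E v d \<Longrightarrow> E (tag c v) (f c v)"
    "\<And>c v b w. E v d \<Longrightarrow> E (tag b w) (f c v) \<Longrightarrow> b = c"
    by metis
  define C where "C c = (?D\<^sup>* `` {f c v}, Restr ?D (?D\<^sup>* `` {f c v}))" for c
  have iso: "K \<simeq> C c" for c
    unfolding K_eq C_def
    by (rule component_iso_embedding[OF R]) (use v f in auto)
  have reach: "?D\<^sup>* `` {f c v} = f c ` (?R\<^sup>* `` {v})" for c
    by (rule reachable_embedding[OF R]) (use v f in auto)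
  have "inj C"
  proof (rule injI)
    fix b c
    assume "C b = C c"
    \<comment> \<open>If the components agree, \<open>f b v\<close> is also a value of
      \<open>f c\<close>; it contains a tag with label \<open>b\<close>, while values of
      \<open>f c\<close> on vertices contain only tags with label \<open>c\<close>.\<close>
    then have "f b v \<in> f c ` (?R\<^sup>* `` {v})"
      unfolding C_def reach by auto
    then obtain w where w: "(v, w) \<in> ?R\<^sup>*" "f b v = f c w" by blast
    from w(1) have "E w d"
      using v R by (induction rule: rtrancl_induct) auto
    then show "b = c" using f(3)[OF v, of b] f(4) w(2) by metis
  qed
  moreover have "C c \<in> {C \<in> components (D_graph E). C \<simeq> K}" for c
    using graph_iso_sym[OF iso] unfolding C_def components_eq D_graph_def
    by (auto simp: Let_def)
  ultimately show ?thesis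
    using infinite_if_inj_family[OF infinite_universe] by blast
qed

end

theorem theorem2p4:
  fixes E :: "'a \<Rightarrow> 'a \<Rightarrow> bool"
  assumes "ZFA_model E"
  shows "(\<forall>C \<in> components (D_graph E).
            \<exists>d r. is_graph_in E d r \<and> (\<exists>K \<in> components (graph_of E d r). C \<simeq> K)) \<and>
         (\<forall>d r. is_graph_in E d r \<longrightarrow>
            (\<forall>K \<in> components (graph_of E d r). \<exists>C \<in> components (D_graph E). K \<simeq> C)) \<and>
         (\<forall>C \<in> components (D_graph E). infinite {C' \<in> components (D_graph E). C' \<simeq> C}) \<and>
         (\<forall>d r. is_graph_in E d r \<longrightarrow>
            (\<forall>K \<in> components (graph_of E d r). infinite {C \<in> components (D_graph E). C \<simeq> K}))"
proof -
  interpret ZFA_model E by (rule assms)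
  have "\<exists>C \<in> components (D_graph E). K \<simeq> C"
    if "is_graph_in E d r" "K \<in> components (graph_of E d r)" for d r K
    using infinite_imp_nonempty[OF infinite_D_components[OF that]] graph_iso_sym by blast
  moreover have "infinite {C' \<in> components (D_graph E). C' \<simeq> C}"
    if C: "C \<in> components (D_graph E)" for C
  proof -
    \<comment> \<open>The count is known for components of graphs in the model; it carries over to
      \<open>C\<close> through an isomorphic \<open>K\<close>.\<close>
    obtain d r K where K: "is_graph_in E d r" "K \<in> components (graph_of E d r)" "C \<simeq> K"
      using D_component_in_graph[OF C] by blast
    have "{C' \<in> components (D_graph E). C' \<simeq> K} \<subseteq> {C' \<in> components (D_graph E). C' \<simeq> C}"
      using graph_iso_trans[OF _ graph_iso_sym[OF K(3)]] by blast
    then show ?thesis using infinite_D_components[OF K(1,2)] infinite_super by blast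
  qed
  ultimately show ?thesis
    using D_component_in_graph infinite_D_components by blast
qed

end
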